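(* There exists a bijection $$\theta_1:\bigsqcup_{i\ge0}(\mathscr{A}^{\mathrm{IV}}_i\times\mathscr{B}^{\mathrm{IV}}_i)\to\mathscr{F}\times\mathscr{D}^{\mathrm{e}},\qquad(\lambda,\mu)\mapsto(\beta,\gamma),$$ such that $|\lambda|+|\mu|=|\beta|+|\gamma|$ and $\ell(\lambda)=\ell(\beta)$. Consequently $$\sum_{i, j\geq 0}\frac{x^iq^{j^2+j+2ij+i}}{(q^2; q^2)_i(q^2; q^2)_j}=\frac{(-q^2; q^2)_{\infty}}{(xq; q^4)_{\infty}}.$$
   Context: Partitions are finite weakly increasing lists of positive integers; $|\lambda|$ is the sum of parts, $\ell(\lambda)$ the number of parts. For $i\ge0$, $\mathscr{A}^{\mathrm{IV}}_i$ is the set of partitions with exactly $i$ parts, all of them odd; $\mathscr{B}^{\mathrm{IV}}_i$ is the set of partitions into distinct even parts whose smallest part is at least $2i+2$. $\mathscr{F}$ is the set of partitions all of whose parts are congruent to $1$ modulo $4$, and $\mathscr{D}^{\mathrm{e}}$ is the set of partitions into distinct even parts. $(a;q)_n=\prod_{k=0}^{n-1}(1-aq^k)$, $(a;q)_\infty=\lim_n(a;q)_n$. *)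

theory Defs
  imports "HOL-Analysis.Analysis" "HOL-Computational_Algebra.Formal_Power_Series"
begin

definition partitions :: "nat list set" where
  "partitions = {p. sorted p \<and> (\<forall>a\<in>set p. 0 < a)}"

definition A_IV :: "nat \<Rightarrow> nat list set" where
  "A_IV i = {p \<in> partitions. length p = i \<and> (\<forall>a\<in>set p. odd a)}"

(* The empty partition has no smallest part and belongs to every B_IV i. *)
definition B_IV :: "nat \<Rightarrow> nat list set" where
  "B_IV i = {p \<in> partitions. distinct p \<and> (\<forall>a\<in>set p. even a) \<and> (\<forall>a\<in>set p. 2 * i + 2 \<le> a)}"

definition F_parts :: "nat list set" where
  "F_parts = {p \<in> partitions. \<forall>a\<in>set p. a mod 4 = 1}"

definition D_e :: "nat list set" where
  "D_e = {p \<in> partitions. distinct p \<and> (\<forall>a\<in>set p. even a)}"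

definition qpoch :: "'a::comm_ring_1 \<Rightarrow> 'a \<Rightarrow> nat \<Rightarrow> 'a" where
  "qpoch a q n = (\<Prod>k<n. 1 - a * q ^ k)"

definition qpoch_inf :: "'a::{comm_ring_1, t2_space} \<Rightarrow> 'a \<Rightarrow> 'a" where
  "qpoch_inf a q = lim (\<lambda>n. qpoch a q n)"

(* The generating functions live in the ring of formal power series in q (outer fps) over the
   formal power series in x (inner fps). The topology that the library puts on the outer fps is
   the q-adic one; limits and infinite sums are taken with respect to it. All divisions
   are by series whose q-constant term is 1, so the library's division is multiplication by the
   genuine inverse although the coefficient ring is not a field. *)
definition gf_x :: "rat fps fps" where
  "gf_x = fps_const fps_X"

definition gf_q :: "rat fps fps" where
  "gf_q = fps_X"

end

theory Submission
  imports Defs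
begin

text \<open>
  Conjugating the partition with parts \<open>(a - 1) / 2\<close>, \<open>a\<close> a part of \<open>\<lambda> \<in> A_IV i\<close>, gives a
  partition with parts at most \<open>i\<close>; let \<open>d\<^sub>k\<close> be the multiplicity of \<open>k\<close> in it. Halving the
  multiplicities gives \<open>d\<^sub>k = 2 e\<^sub>k + \<epsilon>\<^sub>k\<close>. The \<open>e\<^sub>k\<close> are the multiplicities belonging to
  a partition \<open>\<beta>\<close> with \<open>i\<close> parts congruent to 1 modulo 4, and the parts \<open>2 k\<close> with
  \<open>\<epsilon>\<^sub>k = 1\<close> are distinct even numbers up to \<open>2 i\<close>, which together with \<open>\<mu>\<close> form \<open>\<gamma>\<close>.

  For the generating function, summing over \<open>j\<close> by Euler's identity for distinct parts gives
  \<open>(-q^(2i+2); q^2)\<^sub>\<infinity>\<close>, which is \<open>(-q^2; q^2)\<^sub>\<infinity> / (-q^2; q^2)\<^sub>i\<close>. Since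
  \<open>(q^2; q^2)\<^sub>i (-q^2; q^2)\<^sub>i = (q^4; q^4)\<^sub>i\<close>, the sum over \<open>i\<close> is
  Euler's expansion of \<open>1 / (x q; q^4)\<^sub>\<infinity>\<close>. Both Euler identities follow by iterating the
  functional equation that relates the values at \<open>z\<close> and \<open>z q\<close>.
\<close>

subsection \<open>The bijection\<close>

text \<open>
  A weakly increasing list of numbers \<open>\<ge> a\<close> congruent to \<open>a\<close> modulo \<open>c\<close> is encoded by its successive
  differences divided by \<open>c\<close>. In a list of length \<open>i\<close>, the entry at index \<open>k\<close> is the multiplicity of
  the part \<open>i - k\<close> in the conjugate partition.
\<close>

fun parts_of :: "nat \<Rightarrow> nat \<Rightarrow> nat list \<Rightarrow> nat list" where
  "parts_of c a [] = []"
| "parts_of c a (d # ds) = (a + c * d) # parts_of c (a + c * d) ds"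

fun diffs_of :: "nat \<Rightarrow> nat \<Rightarrow> nat list \<Rightarrow> nat list" where
  "diffs_of c a [] = []"
| "diffs_of c a (p # ps) = (p - a) div c # diffs_of c p ps"

text \<open>Size of the partition encoded from \<open>a = 0\<close> with \<open>c = 1\<close>: each
  difference is inherited by all later entries.\<close>

fun weight :: "nat list \<Rightarrow> nat" where
  "weight [] = 0"
| "weight (d # ds) = d * Suc (length ds) + weight ds"

text \<open>The head belongs to the largest conjugate part, so its contribution goes last and the
  result is increasing.\<close>

fun odd_parts :: "nat list \<Rightarrow> nat list" where
  "odd_parts [] = []"
| "odd_parts (d # ds) = odd_parts ds @ (if odd d then [2 * Suc (length ds)] else [])"

text \<open>The image of \<open>parts_of c a\<close>; it gives odd parts and parts congruent to 1
  modulo 4 a common form.\<close>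

definition residue_parts :: "nat \<Rightarrow> nat \<Rightarrow> nat list set" where
  "residue_parts c a = {p. sorted p \<and> (\<forall>b\<in>set p. a \<le> b \<and> b mod c = a mod c)}"

lemma length_parts_of [simp]: "length (parts_of c a ds) = length ds"
  by (induction ds arbitrary: a) simp_all

lemma length_diffs_of [simp]: "length (diffs_of c a ps) = length ps"
  by (induction ps arbitrary: a) simp_all

lemma sum_parts_of: "sum_list (parts_of c a ds) = a * length ds + c * weight ds"
  by (induction ds arbitrary: a) (simp_all add: algebra_simps)

lemma parts_of_ge: "b \<in> set (parts_of c a ds) \<Longrightarrow> a \<le> b \<and> b mod c = a mod c"
  by (induction ds arbitrary: a) (auto dest!: add_leD1)

lemma sorted_parts_of: "sorted (parts_of c a ds)"
  by (induction ds arbitrary: a) (auto dest: parts_of_ge)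

lemma diffs_of_parts_of: "0 < c \<Longrightarrow> diffs_of c a (parts_of c a ds) = ds"
  by (induction ds arbitrary: a) simp_all

lemma parts_of_in_residue_parts: "parts_of c a ds \<in> residue_parts c a"
  using parts_of_ge sorted_parts_of by (auto simp: residue_parts_def)

lemma parts_of_diffs_of: "ps \<in> residue_parts c a \<Longrightarrow> parts_of c a (diffs_of c a ps) = ps"
proof (induction ps arbitrary: a)
  case (Cons p ps)
  then have "a \<le> p" "p mod c = a mod c" "ps \<in> residue_parts c p"
    by (auto simp: residue_parts_def)
  moreover from this have "c dvd p - a"
    by (metis mod_eq_dvd_iff_nat)
  ultimately show ?case
    using Cons.IH by simp
qed simp

lemma A_IV_eq: "A_IV i = {p \<in> residue_parts 2 1. length p = i}"
  by (auto simp: A_IV_def partitions_def residue_parts_def odd_iff_mod_2_eq_one Suc_le_eq)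

lemma F_parts_eq: "F_parts = residue_parts 4 1"
  by (force simp: F_parts_def partitions_def residue_parts_def Suc_le_eq intro: Nat.gr0I)

section \<open>Parities of the multiplicities\<close>

lemma set_odd_parts:
  "set (odd_parts ds) = {2 * (length ds - k) |k. k < length ds \<and> odd (ds ! k)}"
proof (induction ds)
  case (Cons d ds)
  have "{2 * (length (d # ds) - k) |k. k < length (d # ds) \<and> odd ((d # ds) ! k)} =
    (if odd d then {2 * Suc (length ds)} else {}) \<union>
    {2 * (length ds - k) |k. k < length ds \<and> odd (ds ! k)}" (is "?L = ?R")
  proof (intro equalityI subsetI)
    fix b assume "b \<in> ?L"
    then obtain k where "b = 2 * (length (d # ds) - k)" "k < length (d # ds)" "odd ((d # ds) ! k)"
      by blast
    then show "b \<in> ?R" by (cases k) auto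
  next
    fix b assume "b \<in> ?R"
    then consider "odd d" "b = 2 * Suc (length ds)"
      | k where "b = 2 * (length ds - k)" "k < length ds" "odd (ds ! k)"
      by (auto split: if_splits)
    then show "b \<in> ?L"
    proof cases
      case 1
      then show ?thesis by (intro CollectI exI[of _ 0]) simp
    next
      case 2
      then show ?thesis by (intro CollectI exI[of _ "Suc k"]) simp
    qed
  qed
  with Cons show ?case by auto
qed simp

lemma odd_parts_range: "b \<in> set (odd_parts ds) \<Longrightarrow> even b \<and> 0 < b \<and> b \<le> 2 * length ds"
  by (auto simp: set_odd_parts)

lemma sorted_distinct_odd_parts: "sorted (odd_parts ds) \<and> distinct (odd_parts ds)"
  by (induction ds) (force simp: sorted_append dest: odd_parts_range)+

text \<open>A part \<open>k\<close> of multiplicity \<open>d\<close> contributes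
  \<open>2 * d * k\<close>. Splitting \<open>d\<close> into twice its half plus its parity gives
  \<open>4 * (d div 2) * k\<close> and, for odd \<open>d\<close>, the even part
  \<open>2 * k\<close>.\<close>

lemma weight_odd_parts:
  "2 * weight ds = 4 * weight (map (\<lambda>d. d div 2) ds) + sum_list (odd_parts ds)"
proof (induction ds)
  case (Cons d ds)
  have "2 * (d * Suc (length ds)) =
      4 * (d div 2 * Suc (length ds)) + (if odd d then 2 * Suc (length ds) else 0)"
    by (cases "even d") (auto elim!: evenE oddE simp: algebra_simps)
  with Cons show ?case by (simp only: weight.simps odd_parts.simps) (simp add: algebra_simps)
qed simp

text \<open>An entry is determined by its half and its parity. In lists of equal length an index
  stands for the same even number, so the sets record the parities.\<close>

lemma odd_parts_inject:
  assumes "length ds = length es" "set (odd_parts ds) = set (odd_parts es)"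
    "map (\<lambda>d. d div 2) ds = map (\<lambda>d. d div 2) es"
  shows "ds = es"
  using assms
proof (induction ds es rule: list_induct2)
  case (Cons d ds e es)
  \<comment> \<open>The number contributed by an odd head exceeds all those from the tails, so its
    membership alone decides the parity of the head.\<close>
  have "2 * Suc (length ds) \<notin> set (odd_parts ds) \<union> set (odd_parts es)"
    using Cons.hyps by (auto dest: odd_parts_range)
  then have "odd d = odd e" "set (odd_parts ds) = set (odd_parts es)"
    using Cons.prems(1) Cons.hyps by (auto split: if_splits)
  moreover from this have "ds = es" "d div 2 = e div 2" using Cons by auto
  ultimately show ?case
    by (metis div_mult_mod_eq parity_cases)
qed simp

lemma obtain_odd_parts:
  assumes "\<forall>b\<in>S. even b \<and> 0 < b \<and> b \<le> 2 * length es"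
  obtains ds where "map (\<lambda>d. d div 2) ds = es" "set (odd_parts ds) = S"
proof -
  define i where "i = length es"
  \<comment> \<open>Index \<open>k\<close> stands for the conjugate part \<open>i - k\<close>, so
    its entry is made odd exactly when \<open>2 * (i - k)\<close> lies in \<open>S\<close>.\<close>
  define ds where "ds = map (\<lambda>k. 2 * es ! k + (if 2 * (i - k) \<in> S then 1 else 0)) [0..<i]"
  have "map (\<lambda>d. d div 2) ds = es"
    by (rule nth_equalityI) (simp_all add: ds_def i_def)
  moreover have "set (odd_parts ds) = S"
  proof (intro equalityI subsetI)
    fix b assume "b \<in> set (odd_parts ds)"
    then show "b \<in> S" by (auto simp: set_odd_parts ds_def split: if_splits)
  next
    fix b assume "b \<in> S"
    then have b: "even b" "0 < b" "b \<le> 2 * i" using assms by (auto simp: i_def)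
    then obtain m where m: "b = 2 * m" "0 < m" "m \<le> i" by (auto elim: evenE)
    then show "b \<in> set (odd_parts ds)"
      using \<open>b \<in> S\<close> by (auto simp: set_odd_parts ds_def intro!: exI[of _ "i - m"])
  qed
  ultimately show ?thesis using that by blast
qed

text \<open>The numbers in \<open>odd_parts ds\<close> are at most \<open>2 * i\<close> and those in
  \<open>m\<close> at least \<open>2 * i + 2\<close>. Hence the concatenation is sorted, and cutting
  it at \<open>2 * i\<close> recovers both pieces; \<open>i\<close> itself is the length of the list
  of halves.\<close>

lemma bij_betw_odd_parts:
  "bij_betw (\<lambda>(i, ds, m). (map (\<lambda>d. d div 2) ds, odd_parts ds @ m))
     (SIGMA i:UNIV. {ds. length ds = i} \<times> B_IV i) (UNIV \<times> D_e)" (is "bij_betw ?f ?A ?B")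
  unfolding bij_betw_def
proof
  show "inj_on ?f ?A"
  proof (rule inj_onI, clarsimp)
    fix ds m es n
    assume *: "m \<in> B_IV (length ds)" "n \<in> B_IV (length es)"
      "map (\<lambda>d. d div 2) ds = map (\<lambda>d. d div 2) es" "odd_parts ds @ m = odd_parts es @ n"
    then have len: "length ds = length es"
      using map_eq_imp_length_eq by blast
    define small where "small b \<longleftrightarrow> b \<le> 2 * length ds" for b :: nat
    have "filter small (odd_parts ds) = odd_parts ds" "filter small (odd_parts es) = odd_parts es"
      using len by (auto simp: small_def filter_id_conv dest: odd_parts_range)
    moreover have "filter small m = []" "filter small n = []"
      using *(1,2) len by (auto simp: small_def filter_empty_conv B_IV_def)
    ultimately have "odd_parts ds = odd_parts es"
      using arg_cong[OF *(4), of "filter small"] by simp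
    then show "length ds = length es \<and> ds = es \<and> m = n"
      using * len odd_parts_inject[OF len] by simp
  qed
next
  show "?f ` ?A = ?B"
  proof (intro equalityI subsetI)
    fix y assume "y \<in> ?f ` ?A"
    then obtain ds m where y: "y = (map (\<lambda>d. d div 2) ds, odd_parts ds @ m)"
      and m: "m \<in> B_IV (length ds)" by auto
    have "b < c" if "b \<in> set (odd_parts ds)" "c \<in> set m" for b c
      using odd_parts_range[OF that(1)] m that(2) by (force simp: B_IV_def)
    then have "odd_parts ds @ m \<in> D_e"
      using m sorted_distinct_odd_parts[of ds] odd_parts_range[of _ ds]
      by (fastforce simp: B_IV_def D_e_def partitions_def sorted_append)
    then show "y \<in> ?B" using y by simp
  next
    fix y assume "y \<in> ?B"
    then obtain es g where y: "y = (es, g)" and g: "g \<in> D_e" by auto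
    define small where "small b \<longleftrightarrow> b \<le> 2 * length es" for b :: nat
    define s where "s = filter small g"
    define m where "m = filter (\<lambda>b. \<not> small b) g"
    have "\<forall>b\<in>set s. even b \<and> 0 < b \<and> b \<le> 2 * length es"
      using g by (auto simp: s_def small_def D_e_def partitions_def)
    then obtain ds where ds: "map (\<lambda>d. d div 2) ds = es" "set (odd_parts ds) = set s"
      by (rule obtain_odd_parts)
    have len: "length es = length ds" using ds(1) by auto
    have m: "m \<in> B_IV (length ds)"
      using g by (force simp: m_def small_def len B_IV_def D_e_def partitions_def sorted_wrt_filter
          elim!: evenE)
    have gs: "sorted g" "distinct g" using g by (auto simp: D_e_def partitions_def)
    have "odd_parts ds @ m = g"
    proof (rule sorted_distinct_set_unique)
      show "sorted (odd_parts ds @ m)"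
        using sorted_distinct_odd_parts[of ds] gs
        by (auto simp: sorted_append ds(2) s_def m_def small_def sorted_wrt_filter)
      show "distinct (odd_parts ds @ m)"
        using sorted_distinct_odd_parts[of ds] gs by (auto simp: ds(2) s_def m_def)
      show "set (odd_parts ds @ m) = set g"
        by (auto simp: ds(2) s_def m_def)
    qed (use gs in auto)
    then have "y = ?f (length ds, ds, m)" using y ds(1) by simp
    then show "y \<in> ?f ` ?A" using m by blast
  qed
qed

lemma weighted_bijection_IV:
  "\<exists>\<theta> :: nat \<times> nat list \<times> nat list \<Rightarrow> nat list \<times> nat list.
      bij_betw \<theta> (SIGMA i:UNIV. A_IV i \<times> B_IV i) (F_parts \<times> D_e) \<and>
      (\<forall>i. \<forall>l\<in>A_IV i. \<forall>m\<in>B_IV i. \<forall>\<beta> \<gamma>. \<theta> (i, l, m) = (\<beta>, \<gamma>) \<longrightarrow>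
        sum_list l + sum_list m = sum_list \<beta> + sum_list \<gamma> \<and> length l = length \<beta>)"
proof -
  define g where "g = (\<lambda>(i :: nat, l, m :: nat list). (i, diffs_of 2 1 l, m))"
  define f where "f = (\<lambda>(i :: nat, ds, m). (map (\<lambda>d. d div 2) ds, odd_parts ds @ m))"
  define h where "h = (\<lambda>(es, \<gamma> :: nat list). (parts_of 4 1 es, \<gamma>))"
  have "bij_betw g (SIGMA i:UNIV. A_IV i \<times> B_IV i) (SIGMA i:UNIV. {ds. length ds = i} \<times> B_IV i)"
    unfolding g_def A_IV_eq
    by (intro bij_betw_byWitness[where f' = "\<lambda>(i, ds, m). (i, parts_of 2 1 ds, m)"])
      (auto simp: diffs_of_parts_of parts_of_diffs_of
        intro: parts_of_in_residue_parts[of _ 1, simplified])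
  moreover have "bij_betw f (SIGMA i:UNIV. {ds. length ds = i} \<times> B_IV i) (UNIV \<times> D_e)"
    unfolding f_def by (rule bij_betw_odd_parts)
  moreover have "bij_betw h (UNIV \<times> D_e) (F_parts \<times> D_e)"
    unfolding h_def F_parts_eq
    by (intro bij_betw_byWitness[where f' = "\<lambda>(b, \<gamma>). (diffs_of 4 1 b, \<gamma>)"])
      (auto simp: diffs_of_parts_of parts_of_diffs_of
        intro: parts_of_in_residue_parts[of _ 1, simplified])
  ultimately have "bij_betw (h \<circ> (f \<circ> g)) (SIGMA i:UNIV. A_IV i \<times> B_IV i) (F_parts \<times> D_e)"
    by (blast intro: bij_betw_trans)
  moreover have "sum_list l + sum_list m = sum_list \<beta> + sum_list \<gamma> \<and> length l = length \<beta>"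
    if l: "l \<in> A_IV i" and "(h \<circ> (f \<circ> g)) (i, l, m) = (\<beta>, \<gamma>)" for i l m \<beta> \<gamma>
  proof -
    define ds where "ds = diffs_of 2 1 l"
    have \<beta>\<gamma>: "\<beta> = parts_of 4 1 (map (\<lambda>d. d div 2) ds)" "\<gamma> = odd_parts ds @ m"
      using that(2) by (simp_all add: f_def g_def h_def ds_def)
    have "l = parts_of 2 1 ds"
      using l by (simp add: ds_def A_IV_eq parts_of_diffs_of)
    \<comment> \<open>Both encodings start from 1, so the terms linear in the length agree and only
      the weights and \<open>odd_parts\<close> remain to be compared.\<close>
    then show ?thesis
      using weight_odd_parts[of ds] by (simp add: \<beta>\<gamma> sum_parts_of)
  qed
  ultimately show ?thesis by blast
qed

subsection \<open>Formal power series in the adic topology\<close>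

unbundle no vec_syntax
unbundle fps_syntax

text \<open>Convergence means that every coefficient eventually equals that of the limit, and a
  coefficient of a sum depends only on the same coefficients of the summands. This makes
  \<open>has_sum_add\<close> available.\<close>

instance fps :: (ab_group_add) topological_comm_monoid_add
proof
  fix a b :: "'a fps"
  have "\<forall>\<^sub>F p in nhds a \<times>\<^sub>F nhds b. (fst p + snd p) $ n = (a + b) $ n" for n
  proof -
    have "\<forall>\<^sub>F p in nhds a \<times>\<^sub>F nhds b. fst p $ n = a $ n"
      using filterlim_fst[of "nhds a" "nhds b"] unfolding tendsto_fps_iff by blast
    moreover have "\<forall>\<^sub>F p in nhds a \<times>\<^sub>F nhds b. snd p $ n = b $ n"
      using filterlim_snd[of "nhds b" "nhds a"] unfolding tendsto_fps_iff by blast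
    ultimately show ?thesis by eventually_elim simp
  qed
  then show "LIM p nhds a \<times>\<^sub>F nhds b. fst p + snd p :> nhds (a + b)"
    by (simp add: tendsto_fps_iff)
qed

text \<open>Each coefficient of a product involves only finitely many coefficients of the factors.
  This makes \<open>tendsto_mult\<close> and \<open>has_sum_cmult_right\<close> available.\<close>

instance fps :: (ring) topological_semigroup_mult
proof
  fix a b :: "'a fps"
  have "\<forall>\<^sub>F p in nhds a \<times>\<^sub>F nhds b. (fst p * snd p) $ n = (a * b) $ n" for n
  proof -
    have "\<forall>\<^sub>F p in nhds a \<times>\<^sub>F nhds b. \<forall>k\<in>{..n}. fst p $ k = a $ k"
      using filterlim_fst[of "nhds a" "nhds b"] unfolding tendsto_fps_iff
      by (intro eventually_ball_finite) auto
    moreover have "\<forall>\<^sub>F p in nhds a \<times>\<^sub>F nhds b. \<forall>k\<in>{..n}. snd p $ k = b $ k"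
      using filterlim_snd[of "nhds b" "nhds a"] unfolding tendsto_fps_iff
      by (intro eventually_ball_finite) auto
    ultimately show ?thesis by eventually_elim (auto simp: fps_mult_nth intro!: sum.cong)
  qed
  then show "LIM p nhds a \<times>\<^sub>F nhds b. fst p * snd p :> nhds (a * b)"
    by (simp add: tendsto_fps_iff)
qed

text \<open>Once a finite index set contains all indices contributing to coefficient
  \<open>n\<close>, enlarging it leaves that coefficient unchanged.\<close>

lemma fps_has_sum:
  fixes f :: "'i \<Rightarrow> 'a::ab_group_add fps"
  assumes "\<And>n. finite {i \<in> A. f i $ n \<noteq> 0}"
  shows "(f has_sum Abs_fps (\<lambda>n. \<Sum>i | i \<in> A \<and> f i $ n \<noteq> 0. f i $ n)) A"
  unfolding has_sum_def
proof (rule tendsto_fpsI)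
  fix n
  let ?S = "{i \<in> A. f i $ n \<noteq> 0}"
  have "(\<Sum>i\<in>Y. f i $ n) = (\<Sum>i\<in>?S. f i $ n)" if "finite Y \<and> ?S \<subseteq> Y \<and> Y \<subseteq> A" for Y
    using that by (intro sum.mono_neutral_right) auto
  then show "\<forall>\<^sub>F F in finite_subsets_at_top A. sum f F $ n =
      Abs_fps (\<lambda>n. \<Sum>i | i \<in> A \<and> f i $ n \<noteq> 0. f i $ n) $ n"
    unfolding eventually_finite_subsets_at_top fps_sum_nth fps_nth_Abs_fps
    using assms by blast
qed

lemma fps_has_sum_nth_single:
  fixes f :: "'i \<Rightarrow> 'a::ab_group_add fps"
  assumes "(f has_sum S) A" "i \<in> A" "\<And>k. k \<in> A \<Longrightarrow> k \<noteq> i \<Longrightarrow> f k $ n = 0"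
  shows "S $ n = f i $ n"
proof -
  have "\<forall>\<^sub>F F in finite_subsets_at_top A. sum f F $ n = S $ n"
    using assms(1) unfolding has_sum_def tendsto_fps_iff by blast
  then obtain X where X: "finite X \<and> X \<subseteq> A \<and>
      (\<forall>Y. finite Y \<and> X \<subseteq> Y \<and> Y \<subseteq> A \<longrightarrow> sum f Y $ n = S $ n)"
    unfolding eventually_finite_subsets_at_top by (rule exE)
  then have "finite (insert i X) \<and> X \<subseteq> insert i X \<and> insert i X \<subseteq> A"
    using assms(2) by blast
  with X have "S $ n = sum f (insert i X) $ n"
    by metis
  also have "\<dots> = (\<Sum>k\<in>{i}. f k $ n)"
    unfolding fps_sum_nth using X assms(2,3) by (intro sum.mono_neutral_right) auto
  finally show ?thesis by simp
qed

text \<open>Serves to multiply a power series by its variable: the terms move up by one and 0 fills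
  index 0.\<close>

lemma has_sum_nat_shift:
  fixes f :: "nat \<Rightarrow> 'a::{comm_monoid_add, topological_space}"
  assumes "(f has_sum S) UNIV"
  shows "((\<lambda>j. case j of 0 \<Rightarrow> 0 | Suc k \<Rightarrow> f k) has_sum S) UNIV" (is "(?g has_sum S) UNIV")
proof -
  have "(?g has_sum S) (range Suc)"
    using assms by (subst has_sum_reindex) (auto simp: o_def)
  moreover have "(?g has_sum S) (range Suc) = (?g has_sum S) UNIV"
    by (rule has_sum_cong_neutral) (auto split: nat.split)
  ultimately show ?thesis by simp
qed

lemma fps_power_mult_nth_eq_0:
  fixes a f :: "'a::comm_ring_1 fps"
  assumes "a $ 0 = 0" "n < k"
  shows "(a ^ k * f) $ n = 0"
  using startsby_zero_power_prefix[OF assms(1)] assms(2)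
  by (auto simp: fps_mult_nth intro!: sum.neutral)

subsection \<open>Euler's identities\<close>

lemma qpoch_Suc: "qpoch a q (Suc n) = qpoch a q n * (1 - a * q ^ n)"
  by (simp add: qpoch_def)

lemma qpoch_add: "qpoch a q (n + m) = qpoch a q n * qpoch (a * q ^ n) q m"
  by (induction m) (simp_all add: qpoch_Suc qpoch_def[of _ _ 0] power_add mult.assoc)

text \<open>Factorwise this is \<open>(1 - a ^ k) * (1 + a ^ k) = 1 - a ^ (2 * k)\<close>.\<close>

lemma qpoch_neg_mult: "qpoch a a n * qpoch (- a) a n = qpoch (a ^ 2) (a ^ 2) n"
  by (induction n)
    (simp_all add: qpoch_Suc qpoch_def[of _ _ 0] power_mult[symmetric] power2_eq_square
      power_mult_distrib algebra_simps)

lemma qpoch_fps_nth_0: "a $ 0 = 0 \<Longrightarrow> qpoch (a :: 'a::comm_ring_1 fps) q n $ 0 = 1"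
  by (induction n) (simp_all add: qpoch_Suc qpoch_def[of _ _ 0])

text \<open>The factor \<open>1 - a * q ^ n\<close> changes no coefficient below \<open>n\<close>,
  so coefficient \<open>m\<close> is settled after \<open>Suc m\<close> factors. Thus the
  \<open>lim\<close> in \<open>qpoch_inf\<close> is a genuine limit.\<close>

lemma LIMSEQ_qpoch_fps:
  fixes a q :: "'a::comm_ring_1 fps"
  assumes "q $ 0 = 0"
  shows "qpoch a q \<longlonglongrightarrow> qpoch_inf a q"
proof -
  have stable: "qpoch a q (Suc m + k) $ m = qpoch a q (Suc m) $ m" for m k
  proof (induction k)
    case (Suc k)
    have "(qpoch a q (Suc m + k) * (a * q ^ (Suc m + k))) $ m = 0"
      using fps_power_mult_nth_eq_0[OF assms, of m "Suc m + k" "qpoch a q (Suc m + k) * a"]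
      by (simp only: ac_simps)
    with Suc show ?case
      by (simp add: qpoch_Suc[of _ _ "Suc m + k"] right_diff_distrib del: add_Suc)
  qed simp
  have "qpoch a q \<longlonglongrightarrow> Abs_fps (\<lambda>m. qpoch a q (Suc m) $ m)"
  proof (rule tendsto_fpsI)
    fix m
    show "\<forall>\<^sub>F n in sequentially. qpoch a q n $ m = Abs_fps (\<lambda>m. qpoch a q (Suc m) $ m) $ m"
      unfolding eventually_sequentially using stable[of m] le_Suc_ex[of "Suc m"]
      by (intro exI[of _ "Suc m"]) (auto simp del: add_Suc)
  qed
  then show ?thesis
    unfolding qpoch_inf_def by (simp add: limI)
qed

lemma qpoch_inf_fps_nth_0:
  fixes a q :: "'a::comm_ring_1 fps"
  assumes "a $ 0 = 0" "q $ 0 = 0"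
  shows "qpoch_inf a q $ 0 = 1"
proof -
  have "\<forall>\<^sub>F n in sequentially. qpoch a q n $ 0 = qpoch_inf a q $ 0"
    using LIMSEQ_qpoch_fps[OF assms(2)] unfolding tendsto_fps_iff by blast
  then show ?thesis
    using qpoch_fps_nth_0[OF assms(1)] by simp
qed

lemma qpoch_inf_split:
  fixes a q :: "'a::comm_ring_1 fps"
  assumes "q $ 0 = 0"
  shows "qpoch_inf a q = qpoch a q n * qpoch_inf (a * q ^ n) q"
proof -
  have "(\<lambda>m. qpoch a q (m + n)) \<longlonglongrightarrow> qpoch_inf a q"
    by (rule LIMSEQ_ignore_initial_segment[OF LIMSEQ_qpoch_fps[OF assms]])
  moreover have "(\<lambda>m. qpoch a q (m + n)) \<longlonglongrightarrow> qpoch a q n * qpoch_inf (a * q ^ n) q"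
    unfolding add.commute[of _ n] qpoch_add
    by (intro tendsto_mult tendsto_const LIMSEQ_qpoch_fps assms)
  ultimately show ?thesis
    by (rule LIMSEQ_unique)
qed

section \<open>Power series in z and their functional equations\<close>

lemma tendsto_power_series_fps_1:
  fixes q z :: "'a::comm_ring_1 fps" and c :: "nat \<Rightarrow> 'a fps"
  assumes q: "q $ 0 = 0" and c0: "c 0 = 1"
    and F: "\<And>z. z $ 0 = 0 \<Longrightarrow> ((\<lambda>j. z ^ j * c j) has_sum F z) UNIV"
  shows "(\<lambda>n. F (z * q ^ Suc n)) \<longlonglongrightarrow> 1"
proof (rule tendsto_fpsI)
  fix m
  have "F (z * q ^ Suc n) $ m = 1 $ m" if "m < n" for n
  proof -
    \<comment> \<open>The argument \<open>z * q ^ Suc n\<close> has order above \<open>n\<close>, so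
      only the term at index 0 reaches coefficient \<open>m\<close>. The exponent
      \<open>Suc n\<close> also gives it constant term 0 for every \<open>z\<close>, as
      \<open>F\<close> requires.\<close>
    have "((z * q ^ Suc n) ^ k * c k) $ m = 0" if "k \<noteq> 0" for k
    proof -
      have "n * k \<ge> n" using that by simp
      then have "m < Suc n * k"
        using \<open>m < n\<close> unfolding mult_Suc by linarith
      moreover have "(z * q ^ Suc n) ^ k * c k = q ^ (Suc n * k) * (z ^ k * c k)"
        by (simp only: power_mult power_mult_distrib mult.assoc mult.left_commute)
      ultimately show ?thesis
        using fps_power_mult_nth_eq_0[OF q] by simp
    qed
    moreover have "((\<lambda>j. (z * q ^ Suc n) ^ j * c j) has_sum F (z * q ^ Suc n)) UNIV"
      by (rule F) (simp add: q)
    ultimately have "F (z * q ^ Suc n) $ m = ((z * q ^ Suc n) ^ 0 * c 0) $ m"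
      by (intro fps_has_sum_nth_single) auto
    then show ?thesis by (simp add: c0)
  qed
  then show "\<forall>\<^sub>F n in sequentially. F (z * q ^ Suc n) $ m = 1 $ m"
    unfolding eventually_sequentially by (intro exI[of _ "Suc m"]) auto
qed

lemma power_series_fps_has_sum:
  fixes z :: "'a::comm_ring_1 fps"
  assumes "z $ 0 = 0"
  shows "((\<lambda>j. z ^ j * c j) has_sum (\<Sum>\<^sub>\<infinity>j. z ^ j * c j)) UNIV"
proof -
  have "finite {j \<in> UNIV. (z ^ j * c j) $ n \<noteq> 0}" for n
  proof (rule finite_subset)
    show "{j \<in> UNIV. (z ^ j * c j) $ n \<noteq> 0} \<subseteq> {..n}"
      using fps_power_mult_nth_eq_0[OF assms, of n] not_less by blast
  qed simp
  then show ?thesis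
    by (intro has_sum_infsum has_sum_imp_summable[OF fps_has_sum])
qed

text \<open>Here \<open>r k\<close> stands for the reciprocal of \<open>qpoch q q k\<close>,
  expressed through products because the ring need not have division.\<close>

lemma inverse_qpoch_rec:
  assumes "r (Suc k) * qpoch q q (Suc k) = 1" "r k * qpoch q q k = 1"
  shows "r (Suc k) * (1 - q ^ Suc k) = r k"
proof -
  have "r k = r k * (r (Suc k) * qpoch q q (Suc k))"
    using assms by simp
  also have "\<dots> = (r k * qpoch q q k) * (r (Suc k) * (1 - q ^ Suc k))"
    by (simp add: qpoch_Suc ac_simps)
  finally show ?thesis using assms by simp
qed

text \<open>The coefficients satisfy \<open>c (Suc k) * (1 - q ^ Suc k) = q ^ k * c k\<close>, which
  yields \<open>F z = (1 + z) * F (z * q)\<close>. Iteration splits off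
  \<open>qpoch (- z) q n\<close>, and the remaining factor tends to 1.\<close>

lemma euler_distinct_fps:
  fixes q z :: "'a::comm_ring_1 fps"
  assumes q: "q $ 0 = 0" and z: "z $ 0 = 0" and r: "\<And>j. r j * qpoch q q j = 1"
  shows "((\<lambda>j. z ^ j * (q ^ (j choose 2) * r j)) has_sum qpoch_inf (- z) q) UNIV"
proof -
  define c where "c j = q ^ (j choose 2) * r j" for j
  define F where "F z = (\<Sum>\<^sub>\<infinity>j. z ^ j * c j)" for z
  have F: "((\<lambda>j. z ^ j * c j) has_sum F z) UNIV" if "z $ 0 = 0" for z
    unfolding F_def using that by (rule power_series_fps_has_sum)
  have c0: "c 0 = 1"
    using r[of 0] by (simp add: c_def qpoch_def numeral_2_eq_2)
  have rec: "F z = (1 + z) * F (z * q)" if "z $ 0 = 0" for z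
  proof -
    have zq: "((\<lambda>j. (z * q) ^ j * c j) has_sum F (z * q)) UNIV"
      by (rule F) (simp add: q)
    have "((\<lambda>j. (z * q) ^ j * c j + (case j of 0 \<Rightarrow> 0 | Suc k \<Rightarrow> z * ((z * q) ^ k * c k)))
        has_sum F (z * q) + z * F (z * q)) UNIV"
      by (intro has_sum_add has_sum_nat_shift has_sum_cmult_right zq)
    moreover have "(z * q) ^ j * c j + (case j of 0 \<Rightarrow> 0 | Suc k \<Rightarrow> z * ((z * q) ^ k * c k)) = z ^ j * c j" for j
    proof (cases j)
      case (Suc k)
      have "Suc k choose 2 = k + (k choose 2)"
        by (simp add: numeral_2_eq_2)
      then have "c (Suc k) * (1 - q ^ Suc k) = q ^ k * c k"
        using inverse_qpoch_rec[OF r r, of k] by (simp add: c_def power_add mult.assoc)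
      then have "z ^ Suc k * (c (Suc k) * (1 - q ^ Suc k)) = z ^ Suc k * (q ^ k * c k)"
        by simp
      then show ?thesis
        by (simp add: Suc power_mult_distrib algebra_simps)
    qed simp
    ultimately have "((\<lambda>j. z ^ j * c j) has_sum F (z * q) + z * F (z * q)) UNIV"
      by simp
    then show ?thesis
      using has_sum_unique[OF F[OF that]] by (simp add: algebra_simps)
  qed
  have "F z = qpoch (- z) q n * F (z * q ^ n)" for n
  proof (induction n)
    case (Suc n)
    then show ?case
      using rec[of "z * q ^ n"] z by (simp add: qpoch_Suc ac_simps)
  qed (simp add: qpoch_def)
  then have "(\<lambda>n. F z) = (\<lambda>n. qpoch (- z) q (Suc n) * F (z * q ^ Suc n))"
    by blast
  moreover have "(\<lambda>n. qpoch (- z) q (Suc n) * F (z * q ^ Suc n)) \<longlonglongrightarrow> qpoch_inf (- z) q * 1"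
    by (intro tendsto_mult LIMSEQ_Suc LIMSEQ_qpoch_fps tendsto_power_series_fps_1[OF q c0 F] q)
  ultimately have "(\<lambda>n. F z) \<longlonglongrightarrow> qpoch_inf (- z) q"
    by (simp only: mult_1_right)
  then have "F z = qpoch_inf (- z) q"
    by (rule LIMSEQ_unique[OF tendsto_const])
  then show ?thesis
    using F[OF z] by (simp add: c_def)
qed

text \<open>Here the functional equation is \<open>F z * (1 - z) = F (z * q)\<close>, so multiplying
  by \<open>qpoch z q n\<close> moves the argument to \<open>z * q ^ n\<close>, where
  \<open>F\<close> tends to 1.\<close>

lemma euler_partition_fps:
  fixes q z :: "'a::comm_ring_1 fps"
  assumes q: "q $ 0 = 0" and z: "z $ 0 = 0" and r: "\<And>j. r j * qpoch q q j = 1"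
  obtains S where "((\<lambda>j. z ^ j * r j) has_sum S) UNIV" "S * qpoch_inf z q = 1"
proof -
  define F where "F z = (\<Sum>\<^sub>\<infinity>j. z ^ j * r j)" for z
  have F: "((\<lambda>j. z ^ j * r j) has_sum F z) UNIV" if "z $ 0 = 0" for z
    unfolding F_def using that by (rule power_series_fps_has_sum)
  have r0: "r 0 = 1"
    using r[of 0] by (simp add: qpoch_def)
  have rec: "F z * (1 - z) = F (z * q)" if "z $ 0 = 0" for z
  proof -
    have "((\<lambda>j. (z * q) ^ j * r j + (case j of 0 \<Rightarrow> 0 | Suc k \<Rightarrow> z * (z ^ k * r k)))
        has_sum F (z * q) + z * F z) UNIV"
      using q that by (intro has_sum_add has_sum_nat_shift has_sum_cmult_right F) simp_all
    moreover have "(z * q) ^ j * r j + (case j of 0 \<Rightarrow> 0 | Suc k \<Rightarrow> z * (z ^ k * r k)) = z ^ j * r j" for j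
    proof (cases j)
      case (Suc k)
      have "z ^ Suc k * (r (Suc k) * (1 - q ^ Suc k)) = z ^ Suc k * r k"
        using inverse_qpoch_rec[OF r r, of k] by simp
      then show ?thesis
        by (simp add: Suc power_mult_distrib algebra_simps)
    qed simp
    ultimately have "((\<lambda>j. z ^ j * r j) has_sum F (z * q) + z * F z) UNIV"
      by simp
    then have "F z = F (z * q) + z * F z"
      by (rule has_sum_unique[OF F[OF that]])
    then have "F z - z * F z = F (z * q)"
      by (metis add_diff_cancel_right')
    then show ?thesis
      by (simp add: right_diff_distrib mult.commute)
  qed
  have "F z * qpoch z q n = F (z * q ^ n)" for n
  proof (induction n)
    case (Suc n)
    have "F z * qpoch z q (Suc n) = (F z * qpoch z q n) * (1 - z * q ^ n)"
      by (simp add: qpoch_Suc mult.assoc)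
    also have "\<dots> = F (z * q ^ n * q)"
      unfolding Suc by (rule rec) (simp add: z)
    finally show ?case by (simp add: ac_simps)
  qed (simp add: qpoch_def)
  then have "(\<lambda>n. F z * qpoch z q (Suc n)) = (\<lambda>n. F (z * q ^ Suc n))"
    by blast
  moreover have "(\<lambda>n. F z * qpoch z q (Suc n)) \<longlonglongrightarrow> F z * qpoch_inf z q"
    by (intro tendsto_mult tendsto_const LIMSEQ_Suc LIMSEQ_qpoch_fps q)
  moreover have "(\<lambda>n. F (z * q ^ Suc n)) \<longlonglongrightarrow> 1"
    by (rule tendsto_power_series_fps_1[OF q r0 F])
  ultimately have "(\<lambda>n. F (z * q ^ Suc n)) \<longlonglongrightarrow> F z * qpoch_inf z q"
    "(\<lambda>n. F (z * q ^ Suc n)) \<longlonglongrightarrow> 1"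
    by (simp_all only:)
  then have "F z * qpoch_inf z q = 1"
    by (rule LIMSEQ_unique)
  then show ?thesis
    by (rule that[OF F[OF z]])
qed

section \<open>Evaluation of the double series\<close>

lemma generating_function_IV:
  defines "x \<equiv> gf_x" and "q \<equiv> gf_q"
  shows "((\<lambda>(i, j). x ^ i * q ^ (j ^ 2 + j + 2 * i * j + i) /
                        (qpoch (q ^ 2) (q ^ 2) i * qpoch (q ^ 2) (q ^ 2) j))
          has_sum (qpoch_inf (- (q ^ 2)) (q ^ 2) / qpoch_inf (x * q) (q ^ 4))) UNIV"
proof -
  define Q where "Q = q ^ 2"
  have q0: "q $ 0 = 0" and Q0: "Q $ 0 = 0"
    by (simp_all add: q_def Q_def gf_q_def)
  \<comment> \<open>The inverse of an outer series is built from the inverse of its constant term,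
    here 1, so it is genuine although the coefficients do not form a field.\<close>
  have unit: "a * inverse a = 1" if "a $ 0 = 1" for a :: "rat fps fps"
    unfolding fps_inverse_def using that by (intro fps_right_inverse) simp
  have div: "f / a = f * inverse a" if "a $ 0 = 1" for f a :: "rat fps fps"
    using that by (intro fps_divide_unit) simp
  define r where "r j = inverse (qpoch Q Q j)" for j
  have r: "r j * qpoch Q Q j = 1" for j
    using unit[OF qpoch_fps_nth_0[OF Q0]] by (simp add: r_def mult.commute)
  \<comment> \<open>This is the reciprocal of \<open>qpoch (Q ^ 2) (Q ^ 2) j\<close>, the
    coefficient in Euler's expansion with base \<open>q ^ 4\<close>.\<close>
  define R where "R j = r j * inverse (qpoch (- Q) Q j)" for j
  have R: "R j * qpoch (Q ^ 2) (Q ^ 2) j = 1" for j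
  proof -
    have "R j * qpoch (Q ^ 2) (Q ^ 2) j =
        (r j * qpoch Q Q j) * (qpoch (- Q) Q j * inverse (qpoch (- Q) Q j))"
      by (simp add: R_def qpoch_neg_mult[symmetric] ac_simps)
    then show ?thesis
      using r unit[OF qpoch_fps_nth_0[of "- Q" Q j]] Q0 by simp
  qed
  obtain S where S: "((\<lambda>i. (x * q) ^ i * R i) has_sum S) UNIV"
      "S * qpoch_inf (x * q) (Q ^ 2) = 1"
    using euler_partition_fps[of "Q ^ 2" "x * q" R] R Q0 q0 by (auto simp: power2_eq_square)
  have pinf0: "qpoch_inf (x * q) (Q ^ 2) $ 0 = 1"
    using Q0 q0 by (intro qpoch_inf_fps_nth_0) (simp_all add: power2_eq_square)
  define P where "P = qpoch_inf (- Q) Q"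
  \<comment> \<open>The summand regrouped so that for fixed \<open>i\<close> the sum over
    \<open>j\<close> is Euler's series for distinct parts at \<open>Q ^ Suc i\<close>.\<close>
  define f where "f = (\<lambda>(i, j). (x * q) ^ i * r i * ((Q ^ Suc i) ^ j * (Q ^ (j choose 2) * r j)))"
  have inner: "((\<lambda>j. f (i, j)) has_sum P * ((x * q) ^ i * R i)) UNIV" for i
  proof -
    have "P * inverse (qpoch (- Q) Q i) =
        qpoch_inf (- (Q ^ Suc i)) Q * (qpoch (- Q) Q i * inverse (qpoch (- Q) Q i))"
      by (simp add: P_def qpoch_inf_split[OF Q0, of "- Q" i] ac_simps)
    also have "\<dots> = qpoch_inf (- (Q ^ Suc i)) Q"
      using unit[OF qpoch_fps_nth_0[of "- Q" Q i]] Q0 by simp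
    finally have "(x * q) ^ i * r i * qpoch_inf (- (Q ^ Suc i)) Q = P * ((x * q) ^ i * R i)"
      by (simp add: R_def ac_simps)
    moreover have "((\<lambda>j. f (i, j)) has_sum (x * q) ^ i * r i * qpoch_inf (- (Q ^ Suc i)) Q) UNIV"
      unfolding f_def prod.case
      by (intro has_sum_cmult_right euler_distinct_fps Q0 r) (simp add: Q0)
    ultimately show ?thesis by (simp only:)
  qed
  have exponent: "f (i, j) = q ^ (j ^ 2 + j + 2 * i * j + i) * (x ^ i * (r i * r j))" for i j
  proof -
    have "2 * (j choose 2) + j = j ^ 2"
      by (induction j) (simp_all add: numeral_2_eq_2)
    then have "j ^ 2 + j + 2 * i * j + i = i + 2 * (Suc i * j) + 2 * (j choose 2)"
      by (simp add: algebra_simps)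
    then show ?thesis
      by (simp only: f_def prod.case Q_def power_mult[symmetric] power_mult_distrib power_add ac_simps)
  qed
  \<comment> \<open>The exponent of \<open>q\<close> is at least \<open>i\<close> and at least
    \<open>j\<close>, so finitely many pairs contribute to each coefficient and the double sum
    exists.\<close>
  have "finite {p \<in> UNIV. f p $ n \<noteq> 0}" for n
  proof (rule finite_subset)
    have "f (i, j) $ n = 0" if "n < i \<or> n < j" for i j
    proof -
      have "n < j ^ 2 + j + 2 * i * j + i" using that by auto
      then show ?thesis
        unfolding exponent using q0 by (intro fps_power_mult_nth_eq_0)
    qed
    then have "i \<le> n \<and> j \<le> n" if "f (i, j) $ n \<noteq> 0" for i j
      using that by (meson not_le)
    then show "{p \<in> UNIV. f p $ n \<noteq> 0} \<subseteq> {..n} \<times> {..n}"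
      by auto
  qed simp
  then obtain T where T: "(f has_sum T) UNIV"
    by (rule that[OF fps_has_sum])
  \<comment> \<open>The double sum is now evaluated iteratively, first over \<open>j\<close> and
    then over \<open>i\<close>.\<close>
  have "((\<lambda>i. P * ((x * q) ^ i * R i)) has_sum T) UNIV"
    by (rule has_sum_SigmaD[where f = f and B = "\<lambda>_. UNIV"]) (simp_all add: T inner)
  then have "T = P * S"
    by (rule has_sum_unique[OF _ has_sum_cmult_right[OF S(1)]])
  also have "S = S * (qpoch_inf (x * q) (Q ^ 2) * inverse (qpoch_inf (x * q) (Q ^ 2)))"
    using unit[OF pinf0] by simp
  also have "\<dots> = inverse (qpoch_inf (x * q) (Q ^ 2))"
    using S(2) by (simp only: mult.assoc[symmetric] mult_1_left)
  finally have "T = P / qpoch_inf (x * q) (Q ^ 2)"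
    by (simp add: div[OF pinf0])
  moreover have "f (i, j) = x ^ i * q ^ (j ^ 2 + j + 2 * i * j + i) / (qpoch Q Q i * qpoch Q Q j)" for i j
  proof -
    let ?d = "qpoch Q Q i * qpoch Q Q j"
    have d: "?d $ 0 = 1"
      using qpoch_fps_nth_0[OF Q0] by simp
    have "r i * r j = (r i * r j) * (?d * inverse ?d)"
      using unit[OF d] by simp
    also have "\<dots> = (r i * qpoch Q Q i) * (r j * qpoch Q Q j) * inverse ?d"
      by (simp only: ac_simps)
    finally have "r i * r j = inverse ?d"
      using r by simp
    then show ?thesis
      by (simp add: exponent div[OF d] ac_simps)
  qed
  then have "f = (\<lambda>(i, j). x ^ i * q ^ (j ^ 2 + j + 2 * i * j + i) / (qpoch Q Q i * qpoch Q Q j))"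
    by (simp add: fun_eq_iff)
  ultimately show ?thesis
    using T by (simp add: P_def Q_def power_mult[symmetric])
qed

theorem theorem3p1:
  shows "(\<exists>\<theta> :: nat \<times> nat list \<times> nat list \<Rightarrow> nat list \<times> nat list.
            bij_betw \<theta> (SIGMA i:UNIV. A_IV i \<times> B_IV i) (F_parts \<times> D_e) \<and>
            (\<forall>i. \<forall>l\<in>A_IV i. \<forall>m\<in>B_IV i. \<forall>\<beta> \<gamma>. \<theta> (i, l, m) = (\<beta>, \<gamma>) \<longrightarrow>
               sum_list l + sum_list m = sum_list \<beta> + sum_list \<gamma> \<and> length l = length \<beta>)) \<and>
         (let x = gf_x; q = gf_q in
            ((\<lambda>(i, j). x ^ i * q ^ (j ^ 2 + j + 2 * i * j + i) /
                        (qpoch (q ^ 2) (q ^ 2) i * qpoch (q ^ 2) (q ^ 2) j))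
              has_sum (qpoch_inf (- (q ^ 2)) (q ^ 2) / qpoch_inf (x * q) (q ^ 4))) UNIV)"
  using weighted_bijection_IV generating_function_IV by (simp only: Let_def)

end
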